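(* Let $\Delta\in\mathbb{C}^3$ be a triangle triple and let $(\eta,\eta')\in\mathbb{C}^2$. Then, up to translation, point reflection, and permutation of vertex labels, the three median triangles $$\mathcal{M}^{00/01}[\eta,\eta'](\Delta),\quad \mathcal{M}^{01/01}[\eta,\eta'](\Delta),\quad \mathcal{M}^{02/01}[\eta,\eta'](\Delta)$$ provide all the triangles among the triples $\mathcal{M}^{wx/yz}[\eta,\eta'](\Delta)$ with $(w,x,y,z)\in(\mathbb{Z}/3\mathbb{Z})^4$, $y\neq z$. That is, for every such $(w,x,y,z)$, the triangle $\mathcal{M}^{wx/yz}[\eta,\eta'](\Delta)$ can be carried to one of these three triangles by a composition of translations of $\mathbb{C}$, point reflections of $\mathbb{C}$, and permutations of the vertex labels.
   Context: Let $\omega=e^{2\pi i/3}$. A triangle triple is a vector $\Delta=(a_0,a_1,a_2)\in\mathbb{C}^3$ (degenerate triples allowed), viewed as a column vector with coordinates (vertex labels) indexed by $\mathbb{Z}/3\mathbb{Z}$; its centroid is $\frac13(a_0+a_1+a_2)$. Translations $u\mapsto u+c$ and point reflections $u\mapsto 2c-u$ ($c\in\mathbb{C}$) act on triangle triples vertex by vertex. Put $$W=\begin{pmatrix}1&1&1\\1&\omega&\omega^2\\1&\omega^2&\omega\end{pmatrix}.$$ Generalized cevian operator: for $\eta,\eta'\in\mathbb{C}$, $\mathcal{S}[\eta,\eta']:=W\,\mathrm{diag}(1,\eta',\eta)\,W^{-1}\in M_3(\mathbb{C})$, acting on $\mathbb{C}^3$ on the left. It preserves centroids. Generalized median operator: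 for $\eta,\eta'\in\mathbb{C}$ and $w,x,y,z\in\mathbb{Z}/3\mathbb{Z}$ with $y\ne z$, and a triangle triple $\Delta=(a_0,a_1,a_2)$ with $\mathcal{S}[\eta,\eta'](\Delta)=(a_0',a_1',a_2')$, define $\mathcal{M}^{wx/yz}[\eta,\eta'](\Delta)=(a_0'',a_1'',a_2'')$ to be the unique triangle triple having the same centroid as $\Delta$ and satisfying $a'_{x+k}-a_{w+k}=a''_{z+k}-a''_{y+k}$ for all $k\in\mathbb{Z}/3\mathbb{Z}$. *)

theory Defs
  imports "HOL-Analysis.Analysis"
begin

text \<open>Vertex labels are the elements of the numeral type \<open>3\<close>, which is the
  ring of integers modulo 3. The library's
  \<open>vector\<close> enumerates coordinates as 1, 2, 3, hence the 0-based constructor below.\<close>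

type_synonym triangle = "complex ^ 3"

definition triple :: "'a \<Rightarrow> 'a \<Rightarrow> 'a \<Rightarrow> 'a ^ 3" where
  "triple a0 a1 a2 = (\<chi> i. if i = 0 then a0 else if i = 1 then a1 else a2)"

definition centroid :: "triangle \<Rightarrow> complex" where
  "centroid T = (T $ 0 + T $ 1 + T $ 2) / 3"

definition \<omega> :: complex where
  "\<omega> = exp (2 * of_real pi * \<i> / 3)"

definition W :: "complex ^ 3 ^ 3" where
  "W = triple (triple 1 1 1) (triple 1 \<omega> (\<omega>\<^sup>2)) (triple 1 (\<omega>\<^sup>2) \<omega>)"

definition diag :: "complex ^ 3 \<Rightarrow> complex ^ 3 ^ 3" where
  "diag d = (\<chi> i j. if i = j then d $ i else 0)"

definition cevian :: "complex \<Rightarrow> complex \<Rightarrow> complex ^ 3 ^ 3" where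
  "cevian \<eta> \<eta>' = W ** diag (triple 1 \<eta>' \<eta>) ** matrix_inv W"

definition is_median ::
  "3 \<Rightarrow> 3 \<Rightarrow> 3 \<Rightarrow> 3 \<Rightarrow> complex \<Rightarrow> complex \<Rightarrow> triangle \<Rightarrow> triangle \<Rightarrow> bool" where
  "is_median w x y z \<eta> \<eta>' T M \<longleftrightarrow>
     centroid M = centroid T \<and>
     (\<forall>k. (cevian \<eta> \<eta>' *v T) $ (x + k) - T $ (w + k) = M $ (z + k) - M $ (y + k))"

text \<open>Meaningful only for \<open>y \<noteq> z\<close>; see \<open>ex1_median\<close> below.\<close>

definition median ::
  "3 \<Rightarrow> 3 \<Rightarrow> 3 \<Rightarrow> 3 \<Rightarrow> complex \<Rightarrow> complex \<Rightarrow> triangle \<Rightarrow> triangle" where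
  "median w x y z \<eta> \<eta>' T = (THE M. is_median w x y z \<eta> \<eta>' T M)"

definition translate :: "complex \<Rightarrow> triangle \<Rightarrow> triangle" where
  "translate c T = (\<chi> i. T $ i + c)"

definition point_reflect :: "complex \<Rightarrow> triangle \<Rightarrow> triangle" where
  "point_reflect c T = (\<chi> i. 2 * c - T $ i)"

definition relabel :: "(3 \<Rightarrow> 3) \<Rightarrow> triangle \<Rightarrow> triangle" where
  "relabel p T = (\<chi> i. T $ p i)"

inductive carried_to :: "triangle \<Rightarrow> triangle \<Rightarrow> bool" where
  refl: "carried_to T T"
| translate: "carried_to T T' \<Longrightarrow> carried_to T (translate c T')"
| point_reflect: "carried_to T T' \<Longrightarrow> carried_to T (point_reflect c T')"
| relabel: "carried_to T T' \<Longrightarrow> bij p \<Longrightarrow> carried_to T (relabel p T')"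

lemma three_eq_0: "(3::3) = 0"
  by simp

lemma exhaust_label: "i = 0 \<or> i = 1 \<or> i = (2::3)"
  using exhaust_3[of i] by auto

lemma UNIV_label: "(UNIV :: 3 set) = {0, 1, 2}"
  using exhaust_label by auto

lemma all_label: "(\<forall>i::3. P i) \<longleftrightarrow> P 0 \<and> P 1 \<and> P 2"
  by (metis exhaust_label)

lemma label_add: "(1::3) + 1 = 2" "(1::3) + 2 = 0" "(2::3) + 1 = 0" "(2::3) + 2 = 1"
  by simp_all

lemma sum_label: "sum f (UNIV :: 3 set) = f 0 + f 1 + f 2" for f :: "3 \<Rightarrow> 'a::comm_monoid_add"
  unfolding UNIV_label by (simp add: add.assoc)

lemma triple_nth [simp]:
  "triple a b c $ 0 = a" "triple a b c $ 1 = b" "triple a b c $ 2 = c"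
  by (simp_all add: triple_def)

lemma omega_cube: "\<omega> ^ 3 = 1"
  using exp_two_pi_i by (simp add: \<omega>_def ac_simps flip: exp_of_nat_mult)

lemma omega_neq_1: "\<omega> \<noteq> 1"
proof
  assume "\<omega> = 1"
  moreover have "\<omega> = cis (2 * pi / 3)"
    by (simp add: \<omega>_def cis_conv_exp ac_simps)
  ultimately have "cos (2 * pi / 3) = 1"
    by (metis cis.simps(1) one_complex.simps(1))
  then show False by (simp add: cos_120)
qed

lemma omega_sum: "1 + \<omega> + \<omega>\<^sup>2 = 0"
proof -
  have "(\<omega> - 1) * (1 + \<omega> + \<omega>\<^sup>2) = \<omega> ^ 3 - 1" by algebra
  then show ?thesis using omega_cube omega_neq_1 by simp
qed

lemma W_mult_inv:
  defines "V \<equiv> triple (triple (1/3) (1/3) (1/3)) (triple (1/3) (\<omega>\<^sup>2/3) (\<omega>/3)) (triple (1/3) (\<omega>/3) (\<omega>\<^sup>2/3))"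
  shows "W ** V = mat 1" "V ** W = mat 1"
proof -
  have c: "\<omega>\<^sup>2 = - 1 - \<omega>" using omega_sum by algebra
  have d: "\<omega> * \<omega> = - 1 - \<omega>" using c by (simp add: power2_eq_square)
  show "W ** V = mat 1" "V ** W = mat 1"
    by (auto simp: V_def W_def vec_eq_iff all_label matrix_matrix_mult_def sum_label mat_def c
         algebra_simps d simp flip: add_divide_distrib diff_divide_distrib)
qed

lemma W_inv: "W ** matrix_inv W = mat 1" "matrix_inv W ** W = mat 1"
proof -
  have "\<exists>A. W ** A = mat 1 \<and> A ** W = mat 1"
    using W_mult_inv by blast
  from someI_ex[OF this]
  show "W ** matrix_inv W = mat 1" "matrix_inv W ** W = mat 1"
    unfolding matrix_inv_def by blast+
qed

lemma centroid_cevian: "centroid (cevian \<eta> \<eta>' *v T) = centroid T"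
proof -
  define u where "u = matrix_inv W *v T"
  have T: "T = W *v u"
    by (simp add: u_def matrix_vector_mul_assoc W_inv)
  have S: "cevian \<eta> \<eta>' *v T = W *v (diag (triple 1 \<eta>' \<eta>) *v u)"
    by (simp add: u_def cevian_def matrix_vector_mul_assoc matrix_mul_assoc)
  have c: "\<omega>\<^sup>2 = - 1 - \<omega>" using omega_sum by algebra
  have *: "centroid (W *v v) = v $ 0" for v
    by (simp add: centroid_def W_def matrix_vector_mult_def sum_label c algebra_simps)
  show ?thesis
    unfolding S unfolding T *
    by (simp add: diag_def matrix_vector_mult_def sum_label)
qed

lemma ex1_median:
  assumes "y \<noteq> z"
  shows "\<exists>!M. is_median w x y z \<eta> \<eta>' T M"
proof -
  define d where "d = (\<lambda>k. (cevian \<eta> \<eta>' *v T) $ (x + k) - T $ (w + k))"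
  have shift: "(\<Sum>k\<in>UNIV. f (j + k)) = sum f UNIV" for f :: "3 \<Rightarrow> complex" and j
    by (rule sum.reindex_bij_witness[of _ "\<lambda>k. k - j" "\<lambda>k. j + k"]) auto
  have "(\<Sum>k\<in>UNIV. d k) = 0"
    using centroid_cevian[of \<eta> \<eta>' T] unfolding centroid_def divide_cancel_right
    by (simp add: d_def sum_subtractf shift[of "($) T"] shift[of "($) (cevian \<eta> \<eta>' *v T)"] sum_label)
  then have d0: "d 2 = - d 0 - d 1" by (simp add: sum_label) algebra
  let ?P = "\<lambda>M. centroid M = centroid T \<and> (\<forall>k. d k = M $ (z + k) - M $ (y + k))"
  have "\<exists>!M. ?P M"
  proof -
    define g where "g = centroid T"
    define q where "q = (\<lambda>j. if z = y + 1 then d (j - y) else - d (j - z))"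
    have zy: "z = y + 1 \<or> y = z + 1"
      using assms exhaust_label[of y] exhaust_label[of z] by (auto simp: label_add)
    have iff: "(\<forall>k. d k = M $ (z + k) - M $ (y + k)) \<longleftrightarrow> (\<forall>j. q j = M $ (j + 1) - M $ j)" for M :: triangle
    proof (cases "z = y + 1")
      case True
      have "(\<forall>j. d (j - y) = M $ (j + 1) - M $ j) \<longleftrightarrow> (\<forall>k. d k = M $ (y + k + 1) - M $ (y + k))"
        by (metis add_diff_cancel_left' add.commute diff_add_cancel)
      then show ?thesis using True by (simp add: q_def ac_simps)
    next
      case False
      then have y: "y = z + 1" using zy by simp
      have "(\<forall>j. - d (j - z) = M $ (j + 1) - M $ j) \<longleftrightarrow> (\<forall>k. - d k = M $ (z + k + 1) - M $ (z + k))"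
        by (metis add_diff_cancel_left' add.commute diff_add_cancel)
      also have "\<dots> \<longleftrightarrow> (\<forall>k. d k = M $ (z + k) - M $ (z + k + 1))"
        by (metis minus_diff_eq minus_equation_iff)
      finally show ?thesis using False unfolding q_def by (simp add: y ac_simps)
    qed
    have "q 0 + q 1 + q 2 = 0"
    proof -
      have *: "(\<Sum>j\<in>UNIV. d (j - c)) = 0" for c
        using shift[of d "- c"] \<open>(\<Sum>k\<in>UNIV. d k) = 0\<close> by simp
      have "(\<Sum>j\<in>UNIV. q j) = 0"
        by (cases "z = y + 1") (simp_all add: q_def sum_negf * del: sum.insert)
      then show ?thesis by (simp only: sum_label)
    qed
    then have q2: "q 2 = - q 0 - q 1"
      by (metis add.commute add_diff_cancel_left' diff_0 minus_add_distrib diff_conv_add_uminus)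
    have "\<exists>!M::triangle. centroid M = g \<and> (\<forall>j. q j = M $ (j + 1) - M $ j)"
    proof (rule ex1I[of _ "triple (g - (2 * q 0 + q 1)/3) (g + (q 0 - q 1)/3) (g + (q 0 + 2 * q 1)/3)"])
      show "centroid (triple (g - (2 * q 0 + q 1)/3) (g + (q 0 - q 1)/3) (g + (q 0 + 2 * q 1)/3)) = g \<and>
        (\<forall>j. q j = triple (g - (2 * q 0 + q 1)/3) (g + (q 0 - q 1)/3) (g + (q 0 + 2 * q 1)/3) $ (j + 1)
               - triple (g - (2 * q 0 + q 1)/3) (g + (q 0 - q 1)/3) (g + (q 0 + 2 * q 1)/3) $ j)"
        unfolding all_label by (simp add: centroid_def label_add three_eq_0 q2 field_simps)
    next
      fix M :: triangle
      assume M: "centroid M = g \<and> (\<forall>j. q j = M $ (j + 1) - M $ j)"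
      then have g: "g = (M $ 0 + M $ 1 + M $ 2) / 3" and qs: "q 0 = M $ 1 - M $ 0" "q 1 = M $ 2 - M $ 1"
        unfolding all_label by (auto simp: centroid_def)
      show "M = triple (g - (2 * q 0 + q 1)/3) (g + (q 0 - q 1)/3) (g + (q 0 + 2 * q 1)/3)"
        unfolding vec_eq_iff all_label g qs by (simp add: field_simps)
    qed
    then show ?thesis unfolding iff g_def .
  qed
  then show ?thesis unfolding is_median_def d_def .
qed

end

theory Submission
  imports Defs
begin

text \<open>The defining equations for \<open>(w, x)\<close> are those for \<open>(0, x - w)\<close> with \<open>k\<close> shifted by \<open>w\<close>,
  so a median triangle with \<open>z = y + 1\<close> becomes the one for \<open>(0, x - w, 0, 1)\<close> after a cyclic
  relabelling. If instead \<open>y = z + 1\<close>, the right-hand sides change sign, which reflection in the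
  common centroid undoes.\<close>

lemma median_eqI:
  assumes "y \<noteq> z" and "is_median w x y z \<eta> \<eta>' T M"
  shows "median w x y z \<eta> \<eta>' T = M"
  unfolding median_def by (rule the1_equality[where P = "is_median w x y z \<eta> \<eta>' T", OF ex1_median[OF assms(1)] assms(2)])

lemma is_median_median:
  assumes "y \<noteq> z"
  shows "is_median w x y z \<eta> \<eta>' T (median w x y z \<eta> \<eta>' T)"
  unfolding median_def by (rule theI'[OF ex1_median[OF assms]])

lemma centroid_relabel:
  assumes "bij p"
  shows "centroid (relabel p T) = centroid T"
proof -
  have "(\<Sum>i\<in>UNIV. T $ p i) = (\<Sum>i\<in>UNIV. T $ i)"
    using assms by (rule sum.reindex_bij_betw)
  then show ?thesis
    by (simp add: centroid_def relabel_def sum_label)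
qed

text \<open>The equation at \<open>k\<close> is the one for \<open>M\<close> at
  \<open>c + k\<close>: the shift \<open>c\<close> is absorbed by the quantifier over
  \<open>k\<close>, and the relabelling makes up for \<open>b\<close> differing from
  \<open>c\<close>.\<close>

lemma is_median_relabel:
  assumes "is_median w x y z \<eta> \<eta>' T M"
  shows "is_median (w + c) (x + c) (y + b) (z + b) \<eta> \<eta>' T (relabel (\<lambda>j. j + (c - b)) M)"
proof -
  let ?N = "relabel (\<lambda>j. j + (c - b)) M"
  have "centroid ?N = centroid M"
    by (rule centroid_relabel[OF bij_plus_right])
  moreover have "(cevian \<eta> \<eta>' *v T) $ (x + c + k) - T $ (w + c + k)
      = ?N $ (z + b + k) - ?N $ (y + b + k)" for k
  proof -
    have "(cevian \<eta> \<eta>' *v T) $ (x + (c + k)) - T $ (w + (c + k))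
        = M $ (z + (c + k)) - M $ (y + (c + k))"
      using assms unfolding is_median_def by blast
    then show ?thesis
      by (simp add: relabel_def algebra_simps)
  qed
  ultimately show ?thesis
    using assms by (simp add: is_median_def)
qed

lemma centroid_point_reflect: "centroid (point_reflect c T) = 2 * c - centroid T"
  by (simp add: centroid_def point_reflect_def field_simps)

text \<open>Point reflection negates vertex differences; centring it at the centroid keeps the
  centroid fixed.\<close>

lemma is_median_point_reflect:
  assumes "is_median w x y z \<eta> \<eta>' T M"
  shows "is_median w x z y \<eta> \<eta>' T (point_reflect (centroid M) M)"
  using assms unfolding is_median_def centroid_point_reflect
  by (simp add: point_reflect_def)

theorem mainTheorem3:
  fixes \<Delta> :: triangle and \<eta> \<eta>' :: complex and w x y z :: 3
  assumes "y \<noteq> z"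
  shows "\<exists>T \<in> {median 0 0 0 1 \<eta> \<eta>' \<Delta>, median 0 1 0 1 \<eta> \<eta>' \<Delta>, median 0 2 0 1 \<eta> \<eta>' \<Delta>}.
           carried_to (median w x y z \<eta> \<eta>' \<Delta>) T"
proof -
  let ?M = "median w x y z \<eta> \<eta>' \<Delta>"
  have M: "is_median w x y z \<eta> \<eta>' \<Delta> ?M"
    using assms by (rule is_median_median)
  \<comment> \<open>\<open>N\<close> will be \<open>?M\<close> itself or its reflection in its
    centroid.\<close>
  have carried: "carried_to ?M (median 0 (x - w) 0 1 \<eta> \<eta>' \<Delta>)"
    if N: "is_median w x y' (y' + 1) \<eta> \<eta>' \<Delta> N" "carried_to ?M N" for y' N
  proof -
    have "is_median 0 (x - w) 0 1 \<eta> \<eta>' \<Delta> (relabel (\<lambda>j. j + (- w - - y')) N)"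
      \<comment> \<open>These shifts send \<open>w\<close> and \<open>y'\<close> to 0.\<close>
      using is_median_relabel[OF N(1), of "- w" "- y'"] by simp
    then have "median 0 (x - w) 0 1 \<eta> \<eta>' \<Delta> = relabel (\<lambda>j. j + (- w - - y')) N"
      by (rule median_eqI[rotated]) simp
    then show ?thesis
      using carried_to.relabel[OF N(2) bij_plus_right] by metis
  qed
  \<comment> \<open>Distinct residues modulo 3 differ by 1 or -1.\<close>
  have "z = y + 1 \<or> y = z + 1"
    using assms exhaust_label[of y] exhaust_label[of z] by (auto simp: label_add)
  then have "carried_to ?M (median 0 (x - w) 0 1 \<eta> \<eta>' \<Delta>)"
  proof
    assume "z = y + 1"
    then show ?thesis
      using carried M carried_to.refl by metis
  next
    assume "y = z + 1"
    \<comment> \<open>The reflected triangle has \<open>y\<close> and \<open>z\<close> swapped, so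
      \<open>carried\<close> applies with \<open>z\<close> as \<open>y'\<close>.\<close>
    then show ?thesis
      using carried is_median_point_reflect[OF M] carried_to.point_reflect[OF carried_to.refl]
      by metis
  qed
  \<comment> \<open>The three values of \<open>x - w\<close> give the three listed
    triangles.\<close>
  then show ?thesis
    using exhaust_label[of "x - w"] by auto
qed

end
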